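(* Let $A=(A_j\colon j\in[d])$ be a set system on a finite ground set $S$ whose transversal matroid $M[A]$ has rank $d$, and let $V_A=(v_s\colon s\in S)\subset\mathbb{k}^d$ be the generic representation of $M[A]$ described in the context. Then the power ideal \[ I(V_A)=\left(\ell_H^{\rho_H}\colon H\text{ a hyperplane of }V_A\right)\subseteq\mathbb{k}[x_1,\ldots,x_d] \] is a monomial ideal.
   Context: A set system on $S$ is a labeled collection $A=(A_j\colon j\in[d])$ of subsets $A_j\subseteq S$. A partial transversal of $A$ is a set $T=\{s_j\colon j\in J\}$ for some $J\subseteq[d]$, with $s_j\in A_j$ for each $j\in J$ and the $s_j$ distinct; the partial transversals are the independent sets of a matroid $M[A]$ on $S$ (the transversal matroid), assumed here to have rank $d$. Representation: $\mathbb{k}$ is a field containing $\mathbb{R}$ and scalars $v_{j,s}$ ($j\in[d]$, $s\in S$) such that $v_{j,s}=0$ iff $s\notin A_j$, and the nonzero $v_{j,s}$ are algebraically independent transcendentals over $\mathbb{R}$; set $v_s=(v_{j,s})_{j\in[d]}^T\in\mathbb{k}^d$ and $V_A=(v_s\colon s\in S)$. For a vector configuration $V$ spanning $\mathbb{k}^d$: a flat of $V$ is a subset $V\cap L$ with $L$ a linear hyperplane of $\mathbb{k}^d$; an inclusion-maximal flat $H=V\cap L$ is a hyperplane of $V$, $\ell_H\in\mathbb{k}[x_1,\ldots,x_d]$ denotes a linear form defining $L$, and $\rho_H=|V\setminus H|$ (counted with multiplicity/labels). *)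

theory Defs
  imports "HOL-Analysis.Cartesian_Space" "HOL-Library.Poly_Mapping"
begin

text \<open>
  The index set \<open>[d]\<close> is a finite type \<^typ>\<open>'d\<close> with \<open>d = CARD('d)\<close>, so that the space \<open>k^d\<close>
  is \<^typ>\<open>'k ^ 'd\<close>. A polynomial with coefficients in \<^typ>\<open>'a\<close> and variables indexed by \<^typ>\<open>'i\<close>
  is a finitely supported map from exponent vectors to coefficients; multiplication is the
  convolution product of \<^theory>\<open>HOL-Library.Poly_Mapping\<close>.
\<close>

type_synonym ('i, 'a) mpolynomial = "('i \<Rightarrow>\<^sub>0 nat) \<Rightarrow>\<^sub>0 'a"

text \<open>Evaluation at the point \<open>x\<close>, with coefficients mapped along \<open>h\<close>.\<close>

definition poly_eval ::
    "('a::zero \<Rightarrow> 'b::comm_semiring_1) \<Rightarrow> ('i \<Rightarrow> 'b) \<Rightarrow> ('i, 'a) mpolynomial \<Rightarrow> 'b" where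
  "poly_eval h x p =
     (\<Sum>m\<in>Poly_Mapping.keys p. h (Poly_Mapping.lookup p m) *
        (\<Prod>i\<in>Poly_Mapping.keys m. x i ^ Poly_Mapping.lookup m i))"

subsection \<open>Set systems and transversal matroids\<close>

definition set_system :: "'s set \<Rightarrow> ('d \<Rightarrow> 's set) \<Rightarrow> bool" where
  "set_system S A \<longleftrightarrow> (\<forall>j. A j \<subseteq> S)"

definition partial_transversal :: "('d \<Rightarrow> 's set) \<Rightarrow> 's set \<Rightarrow> bool" where
  "partial_transversal A T \<longleftrightarrow>
     (\<exists>J t. T = t ` J \<and> inj_on t J \<and> (\<forall>j\<in>J. t j \<in> A j))"

text \<open>A matroid is represented by its collection of independent sets.\<close>

definition transversal_matroid :: "('d \<Rightarrow> 's set) \<Rightarrow> 's set set" where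
  "transversal_matroid A = {T. partial_transversal A T}"

definition matroid_rank :: "'s set set \<Rightarrow> nat" where
  "matroid_rank \<I> = Max (card ` \<I>)"

subsection \<open>The generic representation\<close>

text \<open>
  Fields containing the reals are the types of class \<^class>\<open>real_field\<close>, with embedding
  \<^const>\<open>of_real\<close>; the class imposes no norm or topology.
\<close>

definition algebraically_independent_over_reals ::
    "'i set \<Rightarrow> ('i \<Rightarrow> 'k::real_field) \<Rightarrow> bool" where
  "algebraically_independent_over_reals I x \<longleftrightarrow>
     (\<forall>p :: ('i, real) mpolynomial.
        (\<forall>m\<in>Poly_Mapping.keys p. Poly_Mapping.keys m \<subseteq> I) \<longrightarrow>
        poly_eval of_real x p = 0 \<longrightarrow> p = 0)"

definition generic_scalars ::
    "'s set \<Rightarrow> ('d \<Rightarrow> 's set) \<Rightarrow> ('d \<Rightarrow> 's \<Rightarrow> 'k::real_field) \<Rightarrow> bool" where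
  "generic_scalars S A v \<longleftrightarrow>
     (\<forall>j. \<forall>s\<in>S. v j s = 0 \<longleftrightarrow> s \<notin> A j) \<and>
     algebraically_independent_over_reals {(j, s). s \<in> S \<and> v j s \<noteq> 0} (\<lambda>(j, s). v j s)"

definition vector_config :: "('d \<Rightarrow> 's \<Rightarrow> 'k) \<Rightarrow> 's \<Rightarrow> 'k ^ 'd" where
  "vector_config v s = (\<chi> j. v j s)"

subsection \<open>Hyperplanes of a vector configuration\<close>

text \<open>
  A configuration is a family \<open>V\<close> of vectors labelled by \<open>S\<close>; subconfigurations, in particular
  flats, are represented by their sets of labels, so repeated vectors count with multiplicity.
\<close>

definition linear_hyperplane :: "('k::field ^ 'd::finite) set \<Rightarrow> bool" where
  "linear_hyperplane L \<longleftrightarrow> vec.subspace L \<and> vec.dim L + 1 = CARD('d)"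

definition config_inter :: "'s set \<Rightarrow> ('s \<Rightarrow> 'k ^ 'd) \<Rightarrow> ('k ^ 'd) set \<Rightarrow> 's set" where
  "config_inter S V L = {s \<in> S. V s \<in> L}"

definition config_flats :: "'s set \<Rightarrow> ('s \<Rightarrow> 'k::field ^ 'd::finite) \<Rightarrow> 's set set" where
  "config_flats S V = {config_inter S V L | L. linear_hyperplane L}"

definition config_hyperplanes :: "'s set \<Rightarrow> ('s \<Rightarrow> 'k::field ^ 'd::finite) \<Rightarrow> 's set set" where
  "config_hyperplanes S V =
     {H \<in> config_flats S V. \<forall>F \<in> config_flats S V. H \<subseteq> F \<longrightarrow> F = H}"

definition linear_form :: "('d::finite, 'k::field) mpolynomial \<Rightarrow> bool" where
  "linear_form p \<longleftrightarrow>
     (\<exists>a. p = (\<Sum>j\<in>UNIV. Poly_Mapping.single (Poly_Mapping.single j 1) (a j)))"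

definition zero_locus :: "('d::finite, 'k::field) mpolynomial \<Rightarrow> ('k ^ 'd) set" where
  "zero_locus p = {x. poly_eval id (\<lambda>j. x $ j) p = 0}"

definition defining_form ::
    "'s set \<Rightarrow> ('s \<Rightarrow> 'k::field ^ 'd::finite) \<Rightarrow> 's set \<Rightarrow> ('d, 'k) mpolynomial \<Rightarrow> bool" where
  "defining_form S V H p \<longleftrightarrow>
     (\<exists>L. linear_hyperplane L \<and> H = config_inter S V L \<and> linear_form p \<and> zero_locus p = L)"

subsection \<open>Power ideals and monomial ideals\<close>

text \<open>Ideals of a commutative ring are its submodules as a module over itself.\<close>

lemma module_over_itself: "module ((*) :: 'a \<Rightarrow> 'a \<Rightarrow> 'a::comm_ring_1)"
  by unfold_locales (simp_all add: algebra_simps)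

definition ideal_generated :: "'a::comm_ring_1 set \<Rightarrow> 'a set" where
  "ideal_generated = module.span (*)"

text \<open>
  The parameter \<open>l\<close> chooses a linear form for each hyperplane; such a form is determined by the
  hyperplane only up to a nonzero scalar.
\<close>

definition power_ideal ::
    "'s set \<Rightarrow> ('s \<Rightarrow> 'k::field ^ 'd::finite) \<Rightarrow> ('s set \<Rightarrow> ('d, 'k) mpolynomial)
       \<Rightarrow> ('d, 'k) mpolynomial set" where
  "power_ideal S V l = ideal_generated {l H ^ card (S - H) | H. H \<in> config_hyperplanes S V}"

definition monomial_ideal :: "('d, 'k::comm_ring_1) mpolynomial set \<Rightarrow> bool" where
  "monomial_ideal I \<longleftrightarrow> (\<exists>M. I = ideal_generated ((\<lambda>m. Poly_Mapping.single m 1) ` M))"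

end

theory Submission
  imports Defs "HOL-Computational_Algebra.Polynomial"
begin

text \<open>
  For a nonempty \<open>J \<subseteq> [d]\<close> let \<open>S_J\<close> be the set of labels \<open>s\<close> such that \<open>v_s\<close> has a nonzero coordinate
  in \<open>J\<close>. The power ideal is generated by the monomials \<open>x^m\<close> for which there is such a \<open>J\<close> containing
  the support of \<open>m\<close> with \<open>|m| + |J| \<ge> |S_J| + 1\<close>.

  If \<open>\<ell>_H\<close> has support \<open>J\<close>, then by genericity it vanishes on fewer than \<open>|J|\<close> of the vectors indexed
  by \<open>S_J\<close>, so \<open>\<rho>_H + |J| \<ge> |S_J| + 1\<close> and every monomial of \<open>\<ell>_H^{\<rho>_H}\<close> is of this kind.

  The converse holds for every configuration. Let \<open>U\<close> be the space of linear forms vanishing on some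
  set of the vectors, \<open>k = dim U \<ge> 1\<close>, and let \<open>n\<close> be the number of vectors on which \<open>U\<close> does not
  vanish. Then all products of at least \<open>n + 1 - k\<close> forms of \<open>U\<close> lie in the power ideal, by induction
  on \<open>k\<close>. The inductive step passes from the sections of \<open>U\<close> by the vectors to \<open>U\<close> itself: a linear
  functional \<open>\<phi>\<close> vanishing on the ideal turns a generic pencil into the univariate polynomial
  \<open>\<phi> ((g + X h)^D)\<close> of degree at most \<open>D < n\<close> with \<open>n\<close> roots counted with multiplicity. So \<open>\<phi>\<close>
  kills \<open>h^D\<close> for generic \<open>h\<close>, and then, by polarization, all products of \<open>D\<close> forms of \<open>U\<close>.
\<close>

section \<open>Linear forms and hyperplanes\<close>

text \<open>Linear forms are identified with their coefficient vectors, so spaces of forms are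
  subspaces of \<open>'k ^ 'd\<close> and have a \<open>vec.dim\<close>.\<close>

definition pairing :: "'k::field ^ 'd::finite \<Rightarrow> 'k ^ 'd \<Rightarrow> 'k" where
  "pairing a w = (\<Sum>j\<in>UNIV. a $ j * w $ j)"

lemma pairing_simps [simp]:
  "pairing (a + b) w = pairing a w + pairing b w"
  "pairing (a - b) w = pairing a w - pairing b w"
  "pairing (c *s a) w = c * pairing a w"
  "pairing a (w + z) = pairing a w + pairing a z"
  "pairing a (w - z) = pairing a w - pairing a z"
  "pairing a (c *s w) = c * pairing a w"
  "pairing 0 w = 0" "pairing a 0 = 0"
  by (simp_all add: pairing_def algebra_simps sum.distrib sum_subtractf sum_distrib_left)

lemma pairing_axis [simp]: "pairing a (axis j 1) = a $ j" "pairing (axis j 1) a = a $ j"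
  by (simp_all add: pairing_def axis_def if_distrib if_distribR cong: if_cong)

lemma pairing_commute: "pairing a w = pairing w a"
  by (simp add: pairing_def mult.commute)

lemma pairing_sum_left: "pairing (\<Sum>i\<in>X. f i) w = (\<Sum>i\<in>X. pairing (f i) w)"
  by (induction X rule: infinite_finite_induct) auto

lemma pairing_nonzero_right: "a \<noteq> 0 \<Longrightarrow> \<exists>w. pairing a w \<noteq> 0"
  by (metis pairing_axis(1) vec_eq_iff zero_index)

text \<open>A basis of \<open>I\<close> stays independent when \<open>f\<close> is added, so values
  can be prescribed on it. The scalar action is a parameter because the lemma serves both
  \<open>k^d\<close> and the polynomial ring.\<close>

lemma separating_functional:
  fixes scale :: "'k::field \<Rightarrow> 'v::ab_group_add \<Rightarrow> 'v"
  assumes "vector_space scale" and "module.subspace scale I" and "f \<notin> I"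
  obtains \<phi> where "Vector_Spaces.linear scale (*) \<phi>" "\<And>x. x \<in> I \<Longrightarrow> \<phi> x = 0" "\<phi> f \<noteq> 0"
proof -
  interpret v: vector_space scale by fact
  interpret vp: vector_space_pair scale "(*) :: 'k \<Rightarrow> 'k \<Rightarrow> 'k"
    by unfold_locales (auto simp: algebra_simps)
  obtain B where B: "B \<subseteq> I" "v.independent B" "I \<subseteq> v.span B"
    using v.maximal_independent_subset by blast
  have "v.span B \<subseteq> I" using B(1) assms(2) by (rule v.span_minimal)
  then have "f \<notin> v.span B" using assms(3) by blast
  then have ind: "v.independent (insert f B)" using B(2) by (rule v.independent_insertI)
  obtain \<phi> where \<phi>: "Vector_Spaces.linear scale (*) \<phi>"
      "\<forall>x\<in>insert f B. \<phi> x = (if x = f then 1 else 0)"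
    using vp.linear_independent_extend[OF ind, of "\<lambda>x. if x = f then 1 else 0"] by blast
  have "\<phi> b = 0" if "b \<in> B" for b
    using \<phi>(2) B(1) assms(3) that by auto
  then have "\<phi> x = 0" if "x \<in> I" for x
    using vp.linear_eq_0_on_span[OF \<phi>(1)] B(3) that by blast
  moreover have "\<phi> f \<noteq> 0" using \<phi>(2) by simp
  ultimately show thesis using \<phi>(1) that by blast
qed

lemma subspace_kernel:
  assumes "vec.subspace U"
  shows "vec.subspace {u \<in> U. pairing u w = 0}"
  using assms by (auto simp: vec.subspace_def)

text \<open>Subtracting the multiple of \<open>h\<close> with the same value at \<open>w\<close>
  moves any \<open>u\<close> into the kernel, so the kernel and \<open>h\<close> together span
  \<open>U\<close>.\<close>

lemma dim_kernel:
  fixes U :: "('k::field ^ 'd::finite) set"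
  assumes U: "vec.subspace U" and h: "h \<in> U" "pairing h w \<noteq> 0"
  shows "vec.dim {u \<in> U. pairing u w = 0} + 1 = vec.dim U"
proof -
  let ?K = "{u \<in> U. pairing u w = 0}"
  have K: "vec.span ?K = ?K" using subspace_kernel[OF U] by (simp add: vec.span_eq_iff)
  have "U \<subseteq> vec.span (insert h ?K)"
  proof
    fix u assume "u \<in> U"
    then have "u - (pairing u w / pairing h w) *s h \<in> ?K"
      using U h by (auto intro!: vec.subspace_diff vec.subspace_scale)
    then show "u \<in> vec.span (insert h ?K)"
      unfolding vec.span_insert K by blast
  qed
  then have "vec.span (insert h ?K) = U"
    using U h(1) vec.span_minimal[of "insert h ?K" U] by auto
  then have "vec.dim U = vec.dim (insert h ?K)" by (metis vec.dim_span)
  also have "\<dots> = vec.dim ?K + 1" using h(2) by (simp add: vec.dim_insert K)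
  finally show ?thesis by simp
qed

lemma dim_vec_UNIV: "vec.dim (UNIV :: ('k::field ^ 'd::finite) set) = CARD('d)"
  by (simp add: card_cart_basis)

lemma linear_hyperplane_iff:
  fixes L :: "('k::field ^ 'd::finite) set"
  shows "linear_hyperplane L \<longleftrightarrow> (\<exists>a. a \<noteq> 0 \<and> L = {w. pairing a w = 0})"
proof
  have *: "linear_hyperplane {w. pairing a w = 0}" if "a \<noteq> 0" for a :: "'k ^ 'd"
  proof -
    have "\<exists>w. pairing a w \<noteq> 0" using that by (rule pairing_nonzero_right)
    then obtain w where "pairing a w \<noteq> 0" by blast
    then show ?thesis
      using dim_kernel[OF vec.subspace_UNIV, of w a] subspace_kernel[OF vec.subspace_UNIV, of a]
      by (simp add: linear_hyperplane_def card_cart_basis pairing_commute[of _ a])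
  qed
  then show "\<exists>a. a \<noteq> 0 \<and> L = {w. pairing a w = 0} \<Longrightarrow> linear_hyperplane L" by blast
  assume L: "linear_hyperplane L"
  then have "L \<noteq> UNIV" by (metis One_nat_def Suc_n_not_n add.commute dim_vec_UNIV linear_hyperplane_def plus_1_eq_Suc)
  then obtain w0 where "w0 \<notin> L" by blast
  then obtain \<phi> where \<phi>: "Vector_Spaces.linear (*s) (*) \<phi>" "\<And>x. x \<in> L \<Longrightarrow> \<phi> x = 0" "\<phi> w0 \<noteq> 0"
    using separating_functional[OF vec.vector_space_axioms, of L w0] L
    by (auto simp: linear_hyperplane_def)
  interpret Vector_Spaces.linear "(*s)" "(*)" \<phi> by fact
  define a where "a = (\<chi> j. \<phi> (axis j 1))"
  have a: "\<phi> w = pairing a w" for w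
  proof -
    have "\<phi> w = \<phi> (\<Sum>j\<in>UNIV. w $ j *s axis j 1)" by (simp add: basis_expansion)
    also have "\<dots> = pairing a w"
      by (simp add: sum scale pairing_def a_def mult.commute)
    finally show ?thesis .
  qed
  have "a \<noteq> 0" using \<phi>(3) a by auto
  \<comment> \<open>Both sides have dimension \<open>CARD('d) - 1\<close>, so one inclusion is
    enough.\<close>
  moreover have "L = {w. pairing a w = 0}"
    using L *[OF \<open>a \<noteq> 0\<close>] \<phi>(2) a
    by (intro vec.subspace_dim_equal) (auto simp: linear_hyperplane_def)
  ultimately show "\<exists>a. a \<noteq> 0 \<and> L = {w. pairing a w = 0}" by blast
qed

text \<open>If \<open>g\<close> works for \<open>W\<close> and \<open>u\<close> for the new vector,
  then \<open>t *s g + u\<close> works for all of them except at finitely many \<open>t\<close>; a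
  field of characteristic 0 is infinite.\<close>

lemma generic_element:
  fixes U :: "('k::field_char_0 ^ 'd::finite) set"
  assumes U: "vec.subspace U" and "finite W" and "\<And>w. w \<in> W \<Longrightarrow> \<exists>u\<in>U. pairing u w \<noteq> 0"
  shows "\<exists>g\<in>U. \<forall>w\<in>W. pairing g w \<noteq> 0"
  using assms(2,3)
proof (induction W)
  case empty
  then show ?case using vec.subspace_0[OF U] by blast
next
  case (insert w W)
  obtain g where g: "g \<in> U" "\<forall>w\<in>W. pairing g w \<noteq> 0" using insert by auto
  obtain u where u: "u \<in> U" "pairing u w \<noteq> 0" using insert by auto
  let ?Z = "insert 0 ((\<lambda>z. - pairing u z / pairing g z) ` insert w W)"
  have "finite ?Z" using insert by simp
  then obtain t where t: "t \<notin> ?Z" using ex_new_if_finite[OF infinite_UNIV_char_0] by blast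
  have "pairing (t *s g + u) z \<noteq> 0" if "z \<in> insert w W" for z
  proof (cases "pairing g z = 0")
    case True
    then show ?thesis using that g(2) u(2) by auto
  next
    case False
    have "t \<noteq> - pairing u z / pairing g z" using t that by blast
    then show ?thesis using False by (simp add: field_simps eq_neg_iff_add_eq_0)
  qed
  moreover have "t *s g + u \<in> U"
    using U g(1) u(1) by (intro vec.subspace_add vec.subspace_scale)
  ultimately show ?case by blast
qed

section \<open>Polynomials and their evaluation\<close>

definition lin :: "'k::field ^ 'd::finite \<Rightarrow> ('d, 'k) mpolynomial" where
  "lin a = (\<Sum>j\<in>UNIV. Poly_Mapping.single (Poly_Mapping.single j 1) (a $ j))"

lemma lin_add: "lin (a + b) = lin a + lin b"
  by (simp add: lin_def single_add sum.distrib)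

lemma lin_scale: "lin (c *s a) = Poly_Mapping.single 0 c * lin a"
  by (simp add: lin_def sum_distrib_left mult_single)

lemma lin_axis: "lin (axis j 1) = Poly_Mapping.single (Poly_Mapping.single j 1) 1"
proof -
  have "lin (axis j 1) = (\<Sum>i\<in>{j}. Poly_Mapping.single (Poly_Mapping.single i 1) (axis j 1 $ i))"
    unfolding lin_def by (intro sum.mono_neutral_right) (auto simp: axis_def)
  then show ?thesis by simp
qed

lemma linear_form_iff: "linear_form p \<longleftrightarrow> (\<exists>a. p = lin a)"
proof
  assume "linear_form p"
  then obtain a where "p = (\<Sum>j\<in>UNIV. Poly_Mapping.single (Poly_Mapping.single j 1) (a j))"
    unfolding linear_form_def by blast
  then have "p = lin (\<chi> j. a j)" by (simp add: lin_def)
  then show "\<exists>a. p = lin a" ..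
qed (auto simp: linear_form_def lin_def)

definition monom_eval :: "('i \<Rightarrow> 'b::comm_semiring_1) \<Rightarrow> ('i \<Rightarrow>\<^sub>0 nat) \<Rightarrow> 'b" where
  "monom_eval x m = (\<Prod>i\<in>Poly_Mapping.keys m. x i ^ Poly_Mapping.lookup m i)"

lemma monom_eval_superset:
  assumes "finite X" "Poly_Mapping.keys m \<subseteq> X"
  shows "monom_eval x m = (\<Prod>i\<in>X. x i ^ Poly_Mapping.lookup m i)"
  unfolding monom_eval_def using assms
  by (intro prod.mono_neutral_left) (auto simp: in_keys_iff)

lemma monom_eval_add: "monom_eval x (m + n) = monom_eval x m * monom_eval x n"
proof -
  let ?X = "Poly_Mapping.keys m \<union> Poly_Mapping.keys n"
  have "monom_eval x (m + n) = (\<Prod>i\<in>?X. x i ^ Poly_Mapping.lookup (m + n) i)"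
    by (intro monom_eval_superset) (auto simp: Poly_Mapping.keys_add)
  also have "\<dots> = (\<Prod>i\<in>?X. x i ^ Poly_Mapping.lookup m i) * (\<Prod>i\<in>?X. x i ^ Poly_Mapping.lookup n i)"
    by (simp add: lookup_add power_add prod.distrib)
  also have "\<dots> = monom_eval x m * monom_eval x n"
    using monom_eval_superset[of ?X m x] monom_eval_superset[of ?X n x] by simp
  finally show ?thesis .
qed

lemma monom_eval_single [simp]: "monom_eval x (Poly_Mapping.single i n) = x i ^ n"
  by (simp add: monom_eval_def)

lemma poly_eval_superset:
  assumes "finite X" "Poly_Mapping.keys p \<subseteq> X" "h 0 = 0"
  shows "poly_eval h x p = (\<Sum>m\<in>X. h (Poly_Mapping.lookup p m) * monom_eval x m)"
  unfolding poly_eval_def monom_eval_def[symmetric] using assms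
  by (intro sum.mono_neutral_left) (auto simp: in_keys_iff)

lemma poly_eval_single:
  "h 0 = 0 \<Longrightarrow> poly_eval h x (Poly_Mapping.single m c) = h c * monom_eval x m"
  by (subst poly_eval_superset[where X = "{m}"]) auto

lemma poly_eval_add:
  assumes "h 0 = 0" "\<And>a b. h (a + b) = h a + h b"
  shows "poly_eval h x (p + q) = poly_eval h x p + poly_eval h x q"
proof -
  let ?X = "Poly_Mapping.keys p \<union> Poly_Mapping.keys q"
  have "poly_eval h x (p + q) = (\<Sum>m\<in>?X. h (Poly_Mapping.lookup (p + q) m) * monom_eval x m)"
    using assms(1) by (intro poly_eval_superset) (auto simp: Poly_Mapping.keys_add)
  also have "\<dots> = (\<Sum>m\<in>?X. h (Poly_Mapping.lookup p m) * monom_eval x m)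
      + (\<Sum>m\<in>?X. h (Poly_Mapping.lookup q m) * monom_eval x m)"
    by (simp add: lookup_add assms(2) algebra_simps sum.distrib)
  also have "\<dots> = poly_eval h x p + poly_eval h x q"
    using poly_eval_superset[of ?X p h x] poly_eval_superset[of ?X q h x] assms(1) by simp
  finally show ?thesis .
qed

lemma poly_eval_sum:
  assumes "h 0 = 0" "\<And>a b. h (a + b) = h a + h b"
  shows "poly_eval h x (\<Sum>i\<in>X. p i) = (\<Sum>i\<in>X. poly_eval h x (p i))"
  by (induction X rule: infinite_finite_induct)
     (use assms in \<open>auto simp: poly_eval_add, auto simp: poly_eval_def\<close>)

lemma poly_mapping_sum_single:
  "p = (\<Sum>m\<in>Poly_Mapping.keys p. Poly_Mapping.single m (Poly_Mapping.lookup p m))"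
  by (rule poly_mapping_eqI) (auto simp: lookup_sum lookup_single when_def in_keys_iff)

lemma poly_eval_mult:
  assumes "h 0 = 0" "\<And>a b. h (a + b) = h a + h b" "\<And>a b. h (a * b) = h a * h b"
  shows "poly_eval h x (p * q) = poly_eval h x p * poly_eval h x q"
proof -
  let ?s = "\<lambda>p m. Poly_Mapping.single m (Poly_Mapping.lookup p m)"
  have "p * q = (\<Sum>m\<in>Poly_Mapping.keys p. \<Sum>n\<in>Poly_Mapping.keys q. ?s p m * ?s q n)"
    by (subst (1) poly_mapping_sum_single[of p], subst (1) poly_mapping_sum_single[of q])
       (simp add: sum_product)
  then have "poly_eval h x (p * q) = (\<Sum>m\<in>Poly_Mapping.keys p. \<Sum>n\<in>Poly_Mapping.keys q.
      (h (Poly_Mapping.lookup p m) * monom_eval x m) * (h (Poly_Mapping.lookup q n) * monom_eval x n))"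
    using assms by (simp add: poly_eval_sum mult_single poly_eval_single monom_eval_add mult_ac)
  also have "\<dots> = poly_eval h x p * poly_eval h x q"
    by (simp add: poly_eval_def monom_eval_def sum_product)
  finally show ?thesis .
qed

lemma poly_eval_lin: "poly_eval id (\<lambda>j. x $ j) (lin a) = pairing a x"
  by (simp add: lin_def poly_eval_sum poly_eval_single pairing_def)

lemma zero_locus_lin: "zero_locus (lin a) = {x. pairing a x = 0}"
  by (simp add: zero_locus_def poly_eval_lin)

text \<open>Puts a monomial into the form in which membership in the power ideal is proved, a
  product of linear forms. One variable of the support is split off at a time.\<close>

lemma prod_list_lin_axis:
  fixes m :: "'d::finite \<Rightarrow>\<^sub>0 nat"
  assumes "Poly_Mapping.keys m \<subseteq> J"
  shows "\<exists>us. set us \<subseteq> (\<lambda>j. axis j 1) ` J \<and> length us = (\<Sum>j\<in>UNIV. Poly_Mapping.lookup m j) \<and>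
    prod_list (map lin us) = (Poly_Mapping.single m 1 :: ('d, 'k::field) mpolynomial)"
  using assms
proof (induction "\<Sum>j\<in>UNIV. Poly_Mapping.lookup m j" arbitrary: m)
  case 0
  then have "m = 0" by (intro poly_mapping_eqI) simp
  then show ?case by (intro exI[of _ "[]"]) auto
next
  case (Suc n)
  then obtain j where j: "Poly_Mapping.lookup m j \<noteq> 0"
    by (metis (mono_tags, lifting) nat.distinct(1) sum.neutral)
  define m' where "m' = m - Poly_Mapping.single j 1"
  have m: "m = m' + Poly_Mapping.single j 1"
    using j by (intro poly_mapping_eqI) (auto simp: m'_def lookup_minus lookup_add lookup_single when_def)
  have sum: "(\<Sum>i\<in>UNIV. Poly_Mapping.lookup m i) = (\<Sum>i\<in>UNIV. Poly_Mapping.lookup m' i) + 1"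
    by (simp add: m lookup_add sum.distrib lookup_single when_def)
  have "Poly_Mapping.keys m' \<subseteq> J"
    using Suc.prems by (auto simp: m'_def in_keys_iff lookup_minus)
  then obtain us :: "('k^'d) list" where us: "set us \<subseteq> (\<lambda>j. axis j 1) ` J"
    "length us = (\<Sum>j\<in>UNIV. Poly_Mapping.lookup m' j)" "prod_list (map lin us) = Poly_Mapping.single m' 1"
    using Suc.hyps(1)[of m'] Suc.hyps(2) sum by auto
  have "j \<in> J" using j Suc.prems by (auto simp: in_keys_iff)
  then show ?case
    using us sum by (intro exI[of _ "axis j 1 # us"])
      (auto simp: lin_axis mult_single m add.commute)
qed

section \<open>Ideals and pencils of linear forms\<close>

lemma ideal_generated_base: "x \<in> G \<Longrightarrow> x \<in> ideal_generated G"
  unfolding ideal_generated_def by (rule module.span_base[OF module_over_itself])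

lemma ideal_generated_zero: "0 \<in> ideal_generated G"
  unfolding ideal_generated_def by (rule module.span_zero[OF module_over_itself])

lemma ideal_generated_add: "x \<in> ideal_generated G \<Longrightarrow> y \<in> ideal_generated G \<Longrightarrow> x + y \<in> ideal_generated G"
  unfolding ideal_generated_def by (rule module.span_add[OF module_over_itself])

lemma ideal_generated_mult: "x \<in> ideal_generated G \<Longrightarrow> r * x \<in> ideal_generated G"
  unfolding ideal_generated_def by (rule module.span_scale[OF module_over_itself])

lemma ideal_generated_mult_right: "x \<in> ideal_generated G \<Longrightarrow> x * r \<in> ideal_generated G"
  using ideal_generated_mult[of x G r] by (simp add: mult.commute)

lemma ideal_generated_sum:
  "(\<And>i. i \<in> X \<Longrightarrow> f i \<in> ideal_generated G) \<Longrightarrow> (\<Sum>i\<in>X. f i) \<in> ideal_generated G"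
  by (induction X rule: infinite_finite_induct) (auto intro: ideal_generated_zero ideal_generated_add)

lemma ideal_generated_minimal: "G \<subseteq> ideal_generated G' \<Longrightarrow> ideal_generated G \<subseteq> ideal_generated G'"
  unfolding ideal_generated_def
  by (intro module.span_minimal[OF module_over_itself] module.subspace_span[OF module_over_itself])

section \<open>The polynomial ring as a vector space, and functionals applied to pencils\<close>

abbreviation poly_scale :: "'k::field \<Rightarrow> ('d, 'k) mpolynomial \<Rightarrow> ('d, 'k) mpolynomial" where
  "poly_scale c p \<equiv> Poly_Mapping.single 0 c * p"

lemma vector_space_poly_scale:
  "vector_space (poly_scale :: 'k::field \<Rightarrow> ('d, 'k) mpolynomial \<Rightarrow> _)"
proof unfold_locales
  fix a b :: 'k and x :: "('d, 'k) mpolynomial"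
  show "poly_scale a (poly_scale b x) = poly_scale (a * b) x"
    by (simp add: mult.assoc[symmetric] mult_single)
qed (simp_all add: algebra_simps single_add)

text \<open>Scalars act through constant polynomials, so an element outside an ideal can be detected
  by a functional that vanishes on the ideal.\<close>

lemma subspace_ideal_generated: "module.subspace poly_scale (ideal_generated G)"
proof -
  have "module poly_scale"
    unfolding module_iff_vector_space by (rule vector_space_poly_scale)
  then show ?thesis
    unfolding module.subspace_def[OF \<open>module poly_scale\<close>]
    by (auto intro: ideal_generated_zero ideal_generated_add ideal_generated_mult)
qed

text \<open>This is \<open>\<phi> ((p + X q) ^ N * r)\<close> with an indeterminate
  \<open>X\<close>. It is given by its binomial coefficients because \<open>\<phi>\<close> is only
  linear over the field. The factor \<open>r\<close> holds forms already split off during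
  polarization.\<close>

definition pencil_poly ::
    "(('d, 'k) mpolynomial \<Rightarrow> 'k) \<Rightarrow> nat \<Rightarrow> ('d, 'k::field) mpolynomial \<Rightarrow> ('d, 'k) mpolynomial
      \<Rightarrow> ('d, 'k) mpolynomial \<Rightarrow> 'k poly" where
  "pencil_poly \<phi> N p q r = (\<Sum>j\<le>N. Polynomial.monom (of_nat (N choose j) * \<phi> (p ^ (N - j) * q ^ j * r)) j)"

lemma coeff_pencil_poly:
  "j \<le> N \<Longrightarrow> coeff (pencil_poly \<phi> N p q r) j = of_nat (N choose j) * \<phi> (p ^ (N - j) * q ^ j * r)"
  by (simp add: pencil_poly_def coeff_sum if_distrib cong: if_cong)

lemma degree_pencil_poly: "Polynomial.degree (pencil_poly \<phi> N p q r) \<le> N"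
  unfolding pencil_poly_def by (intro degree_sum_le) (auto intro: order.trans[OF degree_monom_le])

context
  fixes \<phi> :: "('d, 'k::field_char_0) mpolynomial \<Rightarrow> 'k"
  assumes lin\<phi>: "Vector_Spaces.linear poly_scale (*) \<phi>"
begin

interpretation \<phi>: Vector_Spaces.linear poly_scale "(*)" \<phi> by (rule lin\<phi>)

lemma pencil_expand:
  "\<phi> ((p + poly_scale x q) ^ N * r) = (\<Sum>j\<le>N. of_nat (N choose j) * \<phi> (p ^ (N - j) * q ^ j * r) * x ^ j)"
proof -
  have pow: "Poly_Mapping.single 0 x ^ j = Poly_Mapping.single (0 :: 'd \<Rightarrow>\<^sub>0 nat) (x ^ j)" for j
    by (induction j) (auto simp: mult_single)
  have "(p + poly_scale x q) ^ N * r
      = (\<Sum>j\<le>N. of_nat (N choose j) * (poly_scale x q) ^ j * p ^ (N - j)) * r"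
    by (subst add.commute) (simp only: binomial_ring)
  also have "\<dots> = (\<Sum>j\<le>N. poly_scale (of_nat (N choose j) * x ^ j) (p ^ (N - j) * q ^ j * r))"
    unfolding sum_distrib_right
  proof (intro sum.cong refl)
    fix j
    have "of_nat (N choose j) = (Poly_Mapping.single 0 (of_nat (N choose j)) :: ('d, 'k) mpolynomial)"
      by simp
    then show "of_nat (N choose j) * (poly_scale x q) ^ j * p ^ (N - j) * r
        = poly_scale (of_nat (N choose j) * x ^ j) (p ^ (N - j) * q ^ j * r)"
      by (simp only: power_mult_distrib pow mult_single[of 0 _ 0, simplified, symmetric] mult_ac)
  qed
  finally show ?thesis by (simp only: \<phi>.sum \<phi>.scale) (simp only: mult_ac)
qed

lemma poly_pencil_poly: "poly (pencil_poly \<phi> N p q r) x = \<phi> ((p + poly_scale x q) ^ N * r)"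
  by (simp add: pencil_poly_def poly_sum poly_monom pencil_expand)

text \<open>A polynomial with infinitely many roots is zero, and the binomial coefficients are
  invertible in characteristic 0.\<close>

lemma pencil_coefficient_eq_0:
  assumes "finite Z" "\<And>x. x \<notin> Z \<Longrightarrow> \<phi> ((p + poly_scale x q) ^ N * r) = 0" "j \<le> N"
  shows "\<phi> (p ^ (N - j) * q ^ j * r) = 0"
proof -
  have "- Z \<subseteq> {x. poly (pencil_poly \<phi> N p q r) x = 0}"
    using assms(2) by (auto simp: poly_pencil_poly)
  moreover have "infinite (- Z)"
    using assms(1) by (simp add: infinite_UNIV_char_0 finite_compl)
  ultimately have "pencil_poly \<phi> N p q r = 0"
    by (metis finite_subset poly_roots_finite)
  then show ?thesis using coeff_pencil_poly[OF assms(3), of \<phi> p q r] assms(3) by simp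
qed

text \<open>Writing \<open>p + x q\<close> as \<open>(p + t q) + (x - t) q\<close> gives the Taylor
  expansion at \<open>t\<close>; the hypothesis kills its terms of order below
  \<open>n\<close>.\<close>

lemma pencil_root_multiplicity:
  assumes "\<And>j. j < n \<Longrightarrow> j \<le> N \<Longrightarrow> \<phi> ((p + poly_scale t q) ^ (N - j) * q ^ j * r) = 0"
  shows "[:-t, 1:] ^ n dvd pencil_poly \<phi> N p q r"
proof -
  let ?c = "\<lambda>j. of_nat (N choose j) * \<phi> ((p + poly_scale t q) ^ (N - j) * q ^ j * r)"
  have "pencil_poly \<phi> N p q r = (\<Sum>j\<le>N. smult (?c j) ([:-t, 1:] ^ j))"
  proof (rule poly_ext)
    fix x
    have "p + poly_scale x q = (p + poly_scale t q) + poly_scale (x - t) q"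
      by (simp add: algebra_simps single_diff)
    then have "poly (pencil_poly \<phi> N p q r) x = (\<Sum>j\<le>N. ?c j * (x - t) ^ j)"
      by (simp only: poly_pencil_poly pencil_expand[of "p + poly_scale t q"])
    then show "poly (pencil_poly \<phi> N p q r) x = poly (\<Sum>j\<le>N. smult (?c j) ([:-t, 1:] ^ j)) x"
      by (simp add: poly_sum)
  qed
  also have "[:-t, 1:] ^ n dvd \<dots>"
  proof (rule dvd_sum)
    fix j assume "j \<in> {..N}"
    then show "[:-t, 1:] ^ n dvd smult (?c j) ([:-t, 1:] ^ j)"
      using assms[of j] dvd_smult[OF le_imp_power_dvd[of n j]] by (cases "j < n") auto
  qed
  finally show ?thesis .
qed

text \<open>The labels in \<open>T\<close> count roots with multiplicity: a value attained by
  several labels is a root of at least that order. This gives more than \<open>N\<close> roots in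
  degree at most \<open>N\<close>.\<close>

lemma pencil_poly_eq_0:
  assumes "finite T" "N < card T"
    and "\<And>s j. s \<in> T \<Longrightarrow> j < card {s' \<in> T. t s' = t s} \<Longrightarrow> j \<le> N \<Longrightarrow>
      \<phi> ((p + poly_scale (t s) q) ^ (N - j) * q ^ j * r) = 0"
  shows "pencil_poly \<phi> N p q r = 0"
proof (rule ccontr)
  let ?P = "pencil_poly \<phi> N p q r" and ?M = "image_mset t (mset_set T)"
  assume P: "?P \<noteq> 0"
  have "?M \<subseteq># proots ?P"
  proof (rule mset_subset_eqI)
    fix a
    have count: "count ?M a = card {s' \<in> T. t s' = a}"
      using assms(1) by (simp add: count_image_mset vimage_def Int_def conj_commute)
    show "count ?M a \<le> count (proots ?P) a"
    proof (cases "a \<in> t ` T")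
      case True
      then obtain s where s: "s \<in> T" "a = t s" by blast
      have "[:-t s, 1:] ^ card {s' \<in> T. t s' = t s} dvd ?P"
        by (intro pencil_root_multiplicity assms(3) s(1))
      then show ?thesis using P count unfolding s(2) by (simp add: order_divides)
    next
      case False
      then have "{s' \<in> T. t s' = a} = {}" by blast
      then show ?thesis unfolding count by (simp only: card.empty)
    qed
  qed
  then have "card T \<le> size (proots ?P)"
    by (metis size_image_mset size_mset_mono size_mset_set)
  also have "\<dots> \<le> N" using size_proots_le degree_pencil_poly by (rule order.trans)
  finally show False using assms(2) by simp
qed

end

section \<open>Products of linear forms in the power ideal\<close>

text \<open>Labels with the same section give the same root of a pencil, so their number is the
  required multiplicity. The bound in \<open>sections\<close> is the one met by \<open>D - j\<close>
  copies of a form for every \<open>j\<close> below that multiplicity.\<close>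

lemma products_from_sections:
  fixes U :: "('k::field_char_0 ^ 'd::finite) set" and V :: "'s \<Rightarrow> 'k ^ 'd"
  defines "K \<equiv> \<lambda>s. {u \<in> U. pairing u (V s) = 0}"
  assumes U: "vec.subspace U" and T: "finite T" "D < card T"
    and nz: "\<And>s. s \<in> T \<Longrightarrow> \<exists>u\<in>U. pairing u (V s) \<noteq> 0"
    and sections: "\<And>s us. s \<in> T \<Longrightarrow> set us \<subseteq> K s \<Longrightarrow> D + 1 \<le> length us + card {s' \<in> T. K s' = K s}
      \<Longrightarrow> prod_list (map lin us) \<in> ideal_generated G"
    and us: "set us \<subseteq> U" "length us = D"
  shows "prod_list (map lin us) \<in> ideal_generated G"
proof (rule ccontr)
  assume "prod_list (map lin us) \<notin> ideal_generated G"
  then obtain \<phi> where \<phi>: "Vector_Spaces.linear poly_scale (*) \<phi>"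
      "\<And>x. x \<in> ideal_generated G \<Longrightarrow> \<phi> x = 0" "\<phi> (prod_list (map lin us)) \<noteq> 0"
    by (rule separating_functional[OF vector_space_poly_scale subspace_ideal_generated]) blast
  define generic where "generic h \<longleftrightarrow> h \<in> U \<and> (\<forall>s\<in>T. pairing h (V s) \<noteq> 0)" for h
  have power: "\<phi> (lin h ^ D) = 0" if "generic h" for h
  proof -
    have h: "h \<in> U" "\<And>s. s \<in> T \<Longrightarrow> pairing h (V s) \<noteq> 0"
      using that by (auto simp: generic_def)
    \<comment> \<open>A form \<open>g\<close> is nonzero on this vector iff the quotients of
      \<open>g\<close> by \<open>h\<close> at \<open>V s\<close> and \<open>V s'\<close> differ,
      which will separate the roots of different sections.\<close>
    let ?w = "\<lambda>(s, s'). pairing h (V s') *s V s - pairing h (V s) *s V s'"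
    have "\<exists>g\<in>U. \<forall>w\<in>?w ` {(s, s') \<in> T \<times> T. K s \<noteq> K s'}. pairing g w \<noteq> 0"
    proof (rule generic_element[OF U])
      show "finite (?w ` {(s, s') \<in> T \<times> T. K s \<noteq> K s'})"
        by (rule finite_imageI, rule finite_subset[of _ "T \<times> T"]) (use T(1) in auto)
      fix w assume "w \<in> ?w ` {(s, s') \<in> T \<times> T. K s \<noteq> K s'}"
      then obtain s s' where s: "s \<in> T" "s' \<in> T" "K s \<noteq> K s'" and w: "w = ?w (s, s')" by auto
      show "\<exists>u\<in>U. pairing u w \<noteq> 0"
      proof (rule ccontr)
        assume "\<not> ?thesis"
        \<comment> \<open>As functionals on \<open>U\<close> the two vectors are then proportional,
          so they cut out the same section.\<close>
        then have "pairing h (V s') * pairing u (V s) = pairing h (V s) * pairing u (V s')"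
          if "u \<in> U" for u using that by (auto simp: w)
        then have "pairing u (V s) = 0 \<longleftrightarrow> pairing u (V s') = 0" if "u \<in> U" for u
          using that h(2)[OF s(1)] h(2)[OF s(2)] by (metis mult_eq_0_iff)
        then show False using s(3) by (auto simp: K_def)
      qed
    qed
    then obtain g where g: "g \<in> U"
      "\<And>s s'. s \<in> T \<Longrightarrow> s' \<in> T \<Longrightarrow> K s \<noteq> K s' \<Longrightarrow>
        pairing h (V s') * pairing g (V s) - pairing h (V s) * pairing g (V s') \<noteq> 0"
      by fastforce
    \<comment> \<open>The parameter at which the pencil \<open>g + t h\<close> enters the section
      \<open>K s\<close>.\<close>
    define t where "t s = - (pairing g (V s) / pairing h (V s))" for s
    have tK: "K s = K s'" if "s \<in> T" "s' \<in> T" "t s = t s'" for s s'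
    proof (rule ccontr)
      assume "K s \<noteq> K s'"
      then show False using g(2)[OF that(1,2)] that(3) h(2)[OF that(1)] h(2)[OF that(2)]
        by (simp add: t_def field_simps)
    qed
    have "pencil_poly \<phi> D (lin g) (lin h) 1 = 0"
    proof (rule pencil_poly_eq_0[OF \<phi>(1) T])
      fix s j assume s: "s \<in> T" and j: "j < card {s' \<in> T. t s' = t s}" "j \<le> D"
      let ?u = "g + t s *s h"
      have u: "?u \<in> K s"
        using U g(1) h(1) h(2)[OF s]
        by (auto simp: K_def t_def intro!: vec.subspace_add vec.subspace_diff vec.subspace_scale)
      have "card {s' \<in> T. t s' = t s} \<le> card {s' \<in> T. K s' = K s}"
        using tK[OF _ s] by (intro card_mono finite_subset[OF _ T(1)]) blast+
      then have "prod_list (map lin (replicate (D - j) ?u)) \<in> ideal_generated G"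
        using j u by (intro sections[OF s]) (simp_all add: set_replicate_conv_if)
      then have "lin ?u ^ (D - j) * (lin h ^ j * 1) \<in> ideal_generated G"
        by (intro ideal_generated_mult_right) simp
      then show "\<phi> ((lin g + poly_scale (t s) (lin h)) ^ (D - j) * lin h ^ j * 1) = 0"
        using \<phi>(2) by (simp add: lin_add lin_scale)
    qed
    \<comment> \<open>The coefficient of \<open>X ^ D\<close> is
      \<open>\<phi> (lin h ^ D)\<close>.\<close>
    then show ?thesis
      using coeff_pencil_poly[of D D \<phi> "lin g" "lin h" 1] by simp
  qed
  \<comment> \<open>Copies of \<open>h\<close> are exchanged one by one for arbitrary forms of
    \<open>U\<close>: \<open>h + x u\<close> is generic for all but finitely many \<open>x\<close>,
    so the coefficient of \<open>X\<close> vanishes.\<close>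
  have polarized: "\<phi> (lin h ^ (D - length us) * prod_list (map lin us)) = 0"
    if "generic h" "set us \<subseteq> U" "length us \<le> D" for h us
    using that
  proof (induction us arbitrary: h)
    case Nil
    then show ?case using power by simp
  next
    case (Cons u us)
    let ?Z = "(\<lambda>s. - (pairing h (V s) / pairing u (V s))) ` T"
    have "\<phi> ((lin h + poly_scale x (lin u)) ^ (D - length us) * prod_list (map lin us)) = 0"
      if x: "x \<notin> ?Z" for x
    proof -
      have "pairing (h + x *s u) (V s) \<noteq> 0" if s: "s \<in> T" for s
      proof (cases "pairing u (V s) = 0")
        case True
        then show ?thesis using Cons.prems(1) s by (auto simp: generic_def)
      next
        case False
        have "x \<noteq> - (pairing h (V s) / pairing u (V s))" using x s by blast
        then show ?thesis using False by (simp add: field_simps eq_neg_iff_add_eq_0 add.commute)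
      qed
      then have "generic (h + x *s u)"
        using U Cons.prems by (auto simp: generic_def intro!: vec.subspace_add vec.subspace_scale)
      from Cons.IH[OF this] Cons.prems show ?thesis by (simp add: lin_add lin_scale)
    qed
    from pencil_coefficient_eq_0[where Z = ?Z and j = 1, OF \<phi>(1) _ this] T(1) Cons.prems(3)
    show ?case by (simp add: mult_ac)
  qed
  have "\<exists>h\<in>U. \<forall>w\<in>V ` T. pairing h w \<noteq> 0"
    using nz T(1) by (intro generic_element[OF U]) auto
  then obtain h where "generic h" by (auto simp: generic_def)
  from polarized[OF this us(1)] us(2) \<phi>(3) show False by simp
qed

section \<open>Flats of a configuration and the forms vanishing on them\<close>

lemma config_hyperplane_form:
  fixes V :: "'s \<Rightarrow> 'k::field ^ 'd::finite"
  assumes "defining_form S V H p"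
  obtains a where "p = lin a" "a \<noteq> 0" "H = {s \<in> S. pairing a (V s) = 0}"
proof -
  from assms obtain L a where L: "linear_hyperplane L" "H = config_inter S V L"
      "p = lin a" "zero_locus (lin a) = L"
    unfolding defining_form_def linear_form_iff by blast
  have "L \<noteq> UNIV"
    using L(1) pairing_nonzero_right unfolding linear_hyperplane_iff by blast
  then have "a \<noteq> 0" using L(4) by (auto simp: zero_locus_lin)
  moreover have "H = {s \<in> S. pairing a (V s) = 0}"
    using L(2) by (simp add: L(4)[symmetric] zero_locus_lin config_inter_def)
  ultimately show thesis using L(3) that by blast
qed

text \<open>The hypothesis \<open>max\<close> is maximality of the flat in terms of forms. The form
  \<open>l H\<close> chosen for the flat may differ from \<open>h\<close>, hence the existential
  \<open>a\<close>.\<close>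

lemma power_in_power_ideal:
  fixes V :: "'s \<Rightarrow> 'k::field ^ 'd::finite" and l :: "'s set \<Rightarrow> ('d, 'k) mpolynomial"
  assumes l: "\<And>H. H \<in> config_hyperplanes S V \<Longrightarrow> defining_form S V H (l H)"
    and h: "h \<noteq> 0" "H = {s \<in> S. pairing h (V s) = 0}"
    and max: "\<And>b. b \<noteq> 0 \<Longrightarrow> (\<forall>s\<in>H. pairing b (V s) = 0) \<Longrightarrow> {s \<in> S. pairing b (V s) = 0} = H"
  shows "\<exists>a. a \<noteq> 0 \<and> H = {s \<in> S. pairing a (V s) = 0} \<and> lin a ^ card (S - H) \<in> power_ideal S V l"
proof -
  have flats: "config_flats S V = {{s \<in> S. pairing b (V s) = 0} | b. b \<noteq> 0}"
    unfolding config_flats_def linear_hyperplane_iff config_inter_def by blast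
  have "H \<in> config_hyperplanes S V"
    unfolding config_hyperplanes_def flats using h max by blast
  then have "defining_form S V H (l H)" "l H ^ card (S - H) \<in> power_ideal S V l"
    using l by (auto simp: power_ideal_def intro: ideal_generated_base)
  moreover from this(1) obtain a where "l H = lin a" "a \<noteq> 0" "H = {s \<in> S. pairing a (V s) = 0}"
    by (rule config_hyperplane_form)
  ultimately show ?thesis by auto
qed

definition annihilator :: "('s \<Rightarrow> 'k::field ^ 'd::finite) \<Rightarrow> 's set \<Rightarrow> ('k ^ 'd) set" where
  "annihilator V F = {a. \<forall>s\<in>F. pairing a (V s) = 0}"

lemma subspace_annihilator: "vec.subspace (annihilator V F)"
  by (auto simp: vec.subspace_def annihilator_def)

lemma annihilator_insert: "annihilator V (insert s F) = {u \<in> annihilator V F. pairing u (V s) = 0}"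
  by (auto simp: annihilator_def)

lemma prod_list_lin_multiples:
  assumes "\<And>u. u \<in> set us \<Longrightarrow> \<exists>c. u = c *s a"
  shows "\<exists>r. prod_list (map lin us) = r * lin a ^ length us"
  using assms
proof (induction us)
  case (Cons u us)
  then obtain r where "prod_list (map lin us) = r * lin a ^ length us" by auto
  moreover obtain c where "u = c *s a" using Cons.prems by auto
  ultimately have "prod_list (map lin (u # us)) = (poly_scale c r) * lin a ^ length (u # us)"
    by (simp add: lin_scale mult_ac)
  then show ?case ..
qed simp

text \<open>Induction on the dimension of the space of forms. A section by a vector on which the
  space does not vanish lowers the dimension by one and removes from the count all labels with that
  section, so the degree bound carries over.\<close>

lemma annihilator_products_in_power_ideal:
  fixes V :: "'s \<Rightarrow> 'k::field_char_0 ^ 'd::finite" and l :: "'s set \<Rightarrow> ('d, 'k) mpolynomial"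
  assumes S: "finite S" and l: "\<And>H. H \<in> config_hyperplanes S V \<Longrightarrow> defining_form S V H (l H)"
    and F: "F \<subseteq> S" "vec.dim (annihilator V F) \<ge> 1"
    and us: "set us \<subseteq> annihilator V F"
      "card {s \<in> S. \<exists>a\<in>annihilator V F. pairing a (V s) \<noteq> 0} + 1 \<le> length us + vec.dim (annihilator V F)"
  shows "prod_list (map lin us) \<in> power_ideal S V l"
  using F us
proof (induction "vec.dim (annihilator V F)" arbitrary: F us rule: less_induct)
  case less
  let ?U = "annihilator V F" and ?I = "power_ideal S V l"
  let ?T = "{s \<in> S. \<exists>a\<in>?U. pairing a (V s) \<noteq> 0}"
  obtain h where h: "h \<in> ?U" "h \<noteq> 0"
    using less.prems(2) by (metis not_one_le_zero subsetI singletonI vec.dim_eq_0)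
  let ?H = "{s \<in> S. pairing h (V s) = 0}"
  have FH: "F \<subseteq> ?H" using less.prems(1) h(1) by (auto simp: annihilator_def)
  have TH: "S - ?H \<subseteq> ?T" using h(1) by auto
  have finT: "finite ?T" using S by simp
  note mult = ideal_generated_mult[where G = "{l H ^ card (S - H) | H. H \<in> config_hyperplanes S V}",
      folded power_ideal_def]
  have power: "\<exists>a. a \<noteq> 0 \<and> ?H = {s \<in> S. pairing a (V s) = 0} \<and> lin a ^ card (S - ?H) \<in> ?I"
    if "\<And>b. b \<noteq> 0 \<Longrightarrow> \<forall>s\<in>?H. pairing b (V s) = 0 \<Longrightarrow> {s \<in> S. pairing b (V s) = 0} = ?H"
    by (rule power_in_power_ideal[OF _ h(2) refl]) (erule l, erule (1) that)
  consider "?T = {}" | "vec.dim ?U = 1" | "?T \<noteq> {}" "vec.dim ?U \<ge> 2"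
    using less.prems(2) by linarith
  then show ?case
  proof cases
    \<comment> \<open>All of \<open>S\<close> is a flat here, so the generator has exponent 0 and
      the ideal contains 1.\<close>
    case 1
    then have H: "?H = S" using TH by blast
    then have "{s \<in> S. pairing b (V s) = 0} = ?H" if "\<forall>s\<in>?H. pairing b (V s) = 0" for b
      using that by auto
    then obtain a where "lin a ^ card (S - ?H) \<in> ?I" using power by blast
    then have "1 \<in> ?I" by (simp add: H)
    then show ?thesis using mult[of 1 "prod_list (map lin us)"] by simp
  next
    case 2
    \<comment> \<open>On a line of forms, the nonzero forms all vanish at the same labels. Hence the
      flat is maximal and every product is a multiple of a power of its form.\<close>
    have "vec.span {h} = ?U"
      using h 2 vec.subspace_dim_equal[of "vec.span {h}" ?U] subspace_annihilator[of V F]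
      by (simp add: vec.span_minimal)
    then have multiple: "\<exists>c. u = c *s h" if "u \<in> ?U" for u
      using that by (auto simp: vec.span_singleton)
    have "{s \<in> S. pairing b (V s) = 0} = ?H" if b: "b \<noteq> 0" "\<forall>s\<in>?H. pairing b (V s) = 0" for b
    proof -
      have "b \<in> ?U" using b(2) FH by (auto simp: annihilator_def)
      then obtain c where "b = c *s h" using multiple by blast
      then show ?thesis using b(1) by auto
    qed
    then obtain a where a: "a \<noteq> 0" "?H = {s \<in> S. pairing a (V s) = 0}" "lin a ^ card (S - ?H) \<in> ?I"
      using power by blast
    have "a \<in> ?U" using a(2) FH by (auto simp: annihilator_def)
    then obtain c where c: "a = c *s h" using multiple by blast
    then have "h = inverse c *s a" using a(1) by simp
    then have "\<exists>c. u = c *s a" if "u \<in> ?U" for u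
      using multiple[OF that] by (metis vector_smult_assoc)
    then obtain r where r: "prod_list (map lin us) = r * lin a ^ length us"
      using prod_list_lin_multiples less.prems(3) by (metis subsetD)
    have "card (S - ?H) \<le> length us"
      using card_mono[OF finT TH] less.prems(4) 2 by simp
    then have "lin a ^ length us = lin a ^ (length us - card (S - ?H)) * lin a ^ card (S - ?H)"
      by (simp add: power_add[symmetric])
    then show ?thesis
      unfolding r using mult[OF a(3)] by (simp add: mult.assoc[symmetric])
  next
    case 3
    \<comment> \<open>The least degree allowed by the bound; any further factors are multiplied in
      at the end. Dimension at least 2 makes \<open>D\<close> smaller than
      \<open>card ?T\<close>.\<close>
    define D where "D = card ?T + 1 - vec.dim ?U"
    have cardT: "card ?T \<ge> 1" using 3(1) finT by (simp add: Suc_le_eq card_gt_0_iff)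
    have D: "D < card ?T" "D \<le> length us" using 3(2) less.prems(4) cardT unfolding D_def by linarith+
    have "prod_list (map lin (take D us)) \<in> ?I"
      unfolding power_ideal_def
    proof (rule products_from_sections[OF subspace_annihilator finT D(1)])
      fix s us'
      let ?K = "\<lambda>s. {u \<in> ?U. pairing u (V s) = 0}"
      let ?C = "{s' \<in> ?T. ?K s' = ?K s}"
      let ?U' = "annihilator V (insert s F)"
      assume s: "s \<in> ?T" and us': "set us' \<subseteq> ?K s" "D + 1 \<le> length us' + card ?C"
      obtain a where "a \<in> ?U" "pairing a (V s) \<noteq> 0" using s by blast
      then have dim: "vec.dim ?U' + 1 = vec.dim ?U"
        unfolding annihilator_insert by (rule dim_kernel[OF subspace_annihilator])
      have C: "?C \<subseteq> ?T" by blast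
      \<comment> \<open>All forms of \<open>?U'\<close> vanish at the labels in \<open>?C\<close>,
        since these define the same section as \<open>s\<close>.\<close>
      have "{s \<in> S. \<exists>a\<in>?U'. pairing a (V s) \<noteq> 0} \<subseteq> ?T - ?C"
        unfolding annihilator_insert by blast
      then have "card {s \<in> S. \<exists>a\<in>?U'. pairing a (V s) \<noteq> 0} \<le> card (?T - ?C)"
        using finT by (intro card_mono) auto
      also have "\<dots> = card ?T - card ?C"
        by (rule card_Diff_subset[OF finite_subset[OF C finT] C])
      finally have card: "card {s \<in> S. \<exists>a\<in>?U'. pairing a (V s) \<noteq> 0} \<le> card ?T - card ?C" .
      have "prod_list (map lin us') \<in> ?I"
      proof (rule less.hyps)
        show "vec.dim ?U' < vec.dim ?U" "1 \<le> vec.dim ?U'" using dim 3(2) by linarith+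
        show "insert s F \<subseteq> S" using s less.prems(1) by blast
        show "set us' \<subseteq> ?U'" using us'(1) unfolding annihilator_insert .
        show "card {s \<in> S. \<exists>a\<in>?U'. pairing a (V s) \<noteq> 0} + 1 \<le> length us' + vec.dim ?U'"
          using card us'(2) dim 3(2) card_mono[OF finT C] unfolding D_def by linarith
      qed
      then show "prod_list (map lin us') \<in> ideal_generated {l H ^ card (S - H) | H. H \<in> config_hyperplanes S V}"
        unfolding power_ideal_def .
    next
      show "set (take D us) \<subseteq> ?U" using less.prems(3) set_take_subset by fast
    qed (use D in auto)
    moreover have "prod_list (map lin us) = prod_list (map lin (drop D us)) * prod_list (map lin (take D us))"
      by (metis append_take_drop_id map_append mult.commute prod_list.append)
    ultimately show ?thesis using mult by simp
  qed
qed

section \<open>Genericity\<close>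

text \<open>The subring generated over the reals by the columns in \<open>T\<close>. Only nonzero
  entries serve as variables, since these are the algebraically independent ones.\<close>

definition entry_ring :: "('d \<Rightarrow> 's \<Rightarrow> 'k::real_field) \<Rightarrow> 's set \<Rightarrow> 'k set" where
  "entry_ring v T = {poly_eval of_real (\<lambda>(j, s). v j s) p | p :: ('d \<times> 's, real) mpolynomial.
     \<forall>m\<in>Poly_Mapping.keys p. Poly_Mapping.keys m \<subseteq> {(j, s). s \<in> T \<and> v j s \<noteq> 0}}"

lemma entry_ring_of_real: "of_real r \<in> entry_ring v T"
  unfolding entry_ring_def
  by (intro CollectI exI[of _ "Poly_Mapping.single 0 r"]) (auto simp: poly_eval_single monom_eval_def)

lemma entry_ring_entry: "s \<in> T \<Longrightarrow> v j s \<in> entry_ring v T"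
proof (cases "v j s = 0")
  case True
  then show ?thesis using entry_ring_of_real[of 0 v T] by simp
next
  case False
  assume "s \<in> T"
  with False show ?thesis unfolding entry_ring_def
    by (intro CollectI exI[of _ "Poly_Mapping.single (Poly_Mapping.single (j, s) 1) 1"])
      (auto simp: poly_eval_single)
qed

lemma entry_ring_add:
  fixes v :: "'d \<Rightarrow> 's \<Rightarrow> 'k::real_field"
  assumes "x \<in> entry_ring v T" "y \<in> entry_ring v T"
  shows "x + y \<in> entry_ring v T"
proof -
  from assms obtain p q :: "('d \<times> 's, real) mpolynomial" where
    "x = poly_eval of_real (\<lambda>(j, s). v j s) p" "y = poly_eval of_real (\<lambda>(j, s). v j s) q"
    "\<forall>m\<in>Poly_Mapping.keys p. Poly_Mapping.keys m \<subseteq> {(j, s). s \<in> T \<and> v j s \<noteq> 0}"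
    "\<forall>m\<in>Poly_Mapping.keys q. Poly_Mapping.keys m \<subseteq> {(j, s). s \<in> T \<and> v j s \<noteq> 0}"
    unfolding entry_ring_def by blast
  then show ?thesis using Poly_Mapping.keys_add[of p q] unfolding entry_ring_def
    by (intro CollectI exI[of _ "p + q"]) (simp add: poly_eval_add, blast)
qed

lemma entry_ring_mult:
  fixes v :: "'d \<Rightarrow> 's \<Rightarrow> 'k::real_field"
  assumes "x \<in> entry_ring v T" "y \<in> entry_ring v T"
  shows "x * y \<in> entry_ring v T"
proof -
  from assms obtain p q :: "('d \<times> 's, real) mpolynomial" where
    pq: "x = poly_eval of_real (\<lambda>(j, s). v j s) p" "y = poly_eval of_real (\<lambda>(j, s). v j s) q"
    "\<forall>m\<in>Poly_Mapping.keys p. Poly_Mapping.keys m \<subseteq> {(j, s). s \<in> T \<and> v j s \<noteq> 0}"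
    "\<forall>m\<in>Poly_Mapping.keys q. Poly_Mapping.keys m \<subseteq> {(j, s). s \<in> T \<and> v j s \<noteq> 0}"
    unfolding entry_ring_def by blast
  have "Poly_Mapping.keys m \<subseteq> {(j, s). s \<in> T \<and> v j s \<noteq> 0}" if m: "m \<in> Poly_Mapping.keys (p * q)" for m
  proof -
    obtain a b where ab: "m = a + b" "a \<in> Poly_Mapping.keys p" "b \<in> Poly_Mapping.keys q"
      using m Poly_Mapping.keys_mult[of p q] by blast
    then show ?thesis using pq(3,4) Poly_Mapping.keys_add[of a b] by blast
  qed
  then show ?thesis using pq(1,2) unfolding entry_ring_def
    by (intro CollectI exI[of _ "p * q"]) (simp add: poly_eval_mult)
qed

lemma entry_ring_diff: "x \<in> entry_ring v T \<Longrightarrow> y \<in> entry_ring v T \<Longrightarrow> x - y \<in> entry_ring v T"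
  using entry_ring_add[OF _ entry_ring_mult[OF entry_ring_of_real[of "-1"]]] by fastforce

lemma entry_ring_mono: "T \<subseteq> T' \<Longrightarrow> entry_ring v T \<subseteq> entry_ring v T'"
  unfolding entry_ring_def by fast

lemma entry_ring_sum:
  "(\<And>i. i \<in> X \<Longrightarrow> f i \<in> entry_ring v T) \<Longrightarrow> (\<Sum>i\<in>X. f i) \<in> entry_ring v T"
  by (induction X rule: infinite_finite_induct)
    (use entry_ring_of_real[of 0 v T] in \<open>auto intro: entry_ring_add\<close>)

lemma lookup_mult_single:
  fixes p :: "('i, 'a::comm_semiring_1) mpolynomial"
  shows "Poly_Mapping.lookup (p * Poly_Mapping.single k 1) m
    = (\<Sum>n\<in>Poly_Mapping.keys p. Poly_Mapping.lookup p n when n + k = m)"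
proof -
  have "p * Poly_Mapping.single k 1
      = (\<Sum>n\<in>Poly_Mapping.keys p. Poly_Mapping.single (n + k) (Poly_Mapping.lookup p n))"
    by (subst (1) poly_mapping_sum_single[of p]) (simp add: sum_distrib_right mult_single)
  then show ?thesis by (simp add: lookup_sum lookup_single)
qed

text \<open>The nonzero entries of a new column are independent over the ring of the earlier ones.
  Lifted to polynomials, a linear relation among them has coefficients free of the variables of
  column \<open>t\<close>, so its summands cannot cancel each other.\<close>

lemma generic_column_independent:
  fixes v :: "'d::finite \<Rightarrow> 's \<Rightarrow> 'k::real_field"
  assumes gen: "generic_scalars S A v" and T: "T \<subseteq> S" "t \<in> S" "t \<notin> T"
    and u: "\<And>j. u j \<in> entry_ring v T" "(\<Sum>j\<in>UNIV. u j * v j t) = 0"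
    and j0: "v j0 t \<noteq> 0"
  shows "u j0 = 0"
proof -
  let ?x = "\<lambda>(j, s). v j s" and ?N = "{j. v j t \<noteq> 0}"
  have "\<forall>j. \<exists>p :: ('d \<times> 's, real) mpolynomial. u j = poly_eval of_real ?x p \<and>
      (\<forall>m\<in>Poly_Mapping.keys p. Poly_Mapping.keys m \<subseteq> {(j, s). s \<in> T \<and> v j s \<noteq> 0})"
    using u(1) unfolding entry_ring_def by blast
  then obtain p :: "'d \<Rightarrow> ('d \<times> 's, real) mpolynomial" where
    "\<forall>j. u j = poly_eval of_real ?x (p j) \<and>
      (\<forall>m\<in>Poly_Mapping.keys (p j). Poly_Mapping.keys m \<subseteq> {(j, s). s \<in> T \<and> v j s \<noteq> 0})"
    by (rule exE[OF choice])
  then have p: "\<And>j. u j = poly_eval of_real ?x (p j)"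
      "\<And>j m. m \<in> Poly_Mapping.keys (p j) \<Longrightarrow> Poly_Mapping.keys m \<subseteq> {(j, s). s \<in> T \<and> v j s \<noteq> 0}"
    by blast+
  let ?k = "\<lambda>j. Poly_Mapping.single (j, t) (1::nat)"
  define q where "q = (\<Sum>j\<in>?N. p j * Poly_Mapping.single (?k j) 1)"
  have "poly_eval of_real ?x q = (\<Sum>j\<in>?N. u j * v j t)"
    by (simp add: q_def poly_eval_sum poly_eval_mult poly_eval_single p(1))
  also have "\<dots> = (\<Sum>j\<in>UNIV. u j * v j t)"
    by (intro sum.mono_neutral_left) auto
  finally have "poly_eval of_real ?x q = 0" using u(2) by simp
  moreover have "Poly_Mapping.keys m \<subseteq> {(j, s). s \<in> S \<and> v j s \<noteq> 0}" if m: "m \<in> Poly_Mapping.keys q" for m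
  proof -
    have "m \<in> (\<Union>j\<in>?N. Poly_Mapping.keys (p j * Poly_Mapping.single (?k j) 1))"
      using m Poly_Mapping.keys_sum[of "\<lambda>j. p j * Poly_Mapping.single (?k j) 1" ?N]
      unfolding q_def by blast
    then obtain j where j: "v j t \<noteq> 0" "m \<in> Poly_Mapping.keys (p j * Poly_Mapping.single (?k j) 1)"
      by blast
    then obtain n where "n \<in> Poly_Mapping.keys (p j)" "m = n + ?k j"
      using Poly_Mapping.keys_mult[of "p j" "Poly_Mapping.single (?k j) 1"] by auto
    then show ?thesis
      using p(2)[of n j] T(1,2) j(1) Poly_Mapping.keys_add[of n "?k j"] by auto
  qed
  ultimately have "q = 0"
    using gen unfolding generic_scalars_def algebraically_independent_over_reals_def by blast
  have "Poly_Mapping.keys (p j0) = {}"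
  proof (rule equals0I)
    fix m assume m: "m \<in> Poly_Mapping.keys (p j0)"
    have avoid: "Poly_Mapping.lookup n (j, t) = 0" if "n \<in> Poly_Mapping.keys (p i)" for n i j
      using p(2)[OF that] T(3) by (auto simp: in_keys_iff)
    \<comment> \<open>The exponent of the variable \<open>(j, t)\<close> reveals which summand a
      monomial comes from.\<close>
    have other: "n + ?k j = m + ?k j0 \<longleftrightarrow> j = j0 \<and> n = m" if "n \<in> Poly_Mapping.keys (p j)" for n j
    proof
      assume eq: "n + ?k j = m + ?k j0"
      have "Poly_Mapping.lookup (n + ?k j) (j, t) = Poly_Mapping.lookup (m + ?k j0) (j, t)"
        by (simp only: eq)
      then have "j = j0"
        using avoid[OF that] avoid[OF m] by (simp add: lookup_add lookup_single when_def split: if_splits)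
      then show "j = j0 \<and> n = m" using eq by simp
    qed simp
    have "0 = Poly_Mapping.lookup q (m + ?k j0)" by (simp add: \<open>q = 0\<close>)
    also have "\<dots> = (\<Sum>j\<in>?N. \<Sum>n\<in>Poly_Mapping.keys (p j). Poly_Mapping.lookup (p j) n when n + ?k j = m + ?k j0)"
      by (simp add: q_def lookup_sum lookup_mult_single)
    also have "\<dots> = (\<Sum>j\<in>?N. \<Sum>n\<in>Poly_Mapping.keys (p j). Poly_Mapping.lookup (p j) n when j = j0 \<and> n = m)"
      by (intro sum.cong refl) (simp only: other)
    also have "\<dots> = (\<Sum>j\<in>?N. (\<Sum>n\<in>Poly_Mapping.keys (p j0). Poly_Mapping.lookup (p j0) n when n = m) when j = j0)"
      by (intro sum.cong refl) (auto simp: when_def)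
    also have "\<dots> = Poly_Mapping.lookup (p j0) m"
      using j0 m by (simp add: when_def)
    finally show False using m by (simp add: in_keys_iff)
  qed
  then show ?thesis by (simp add: p(1) poly_eval_def)
qed

text \<open>
  Gaussian elimination over the ring generated by the entries: each vector of \<open>C\<close> in turn removes one
  member from a family that spans \<open>a\<close> and has entries in that ring, since the new vector is generic
  over it; the family never becomes empty.
\<close>

lemma card_annihilated_generic_vectors:
  fixes v :: "'d::finite \<Rightarrow> 's \<Rightarrow> 'k::real_field" and a :: "'k ^ 'd"
  assumes gen: "generic_scalars S A v" and a: "a \<noteq> 0" and "finite C" "C \<subseteq> S"
    and C: "\<And>s. s \<in> C \<Longrightarrow> \<exists>j. a $ j \<noteq> 0 \<and> v j s \<noteq> 0"
      "\<And>s. s \<in> C \<Longrightarrow> pairing a (vector_config v s) = 0"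
  shows "card C < card {j. a $ j \<noteq> 0}"
proof -
  have "\<exists>(L :: 'd set) u c. card L + card C = card {j. a $ j \<noteq> 0} \<and>
      (\<forall>l\<in>L. \<forall>j. u l $ j \<in> entry_ring v C) \<and> a = (\<Sum>l\<in>L. c l *s u l)"
    using \<open>finite C\<close> \<open>C \<subseteq> S\<close> C
  proof (induction C)
    case empty
    \<comment> \<open>The initial family consists of the unit vectors on the support of
      \<open>a\<close>.\<close>
    have "axis l 1 $ j \<in> entry_ring v {}" for l j
      using entry_ring_of_real[of 0 v "{}"] entry_ring_of_real[of 1 v "{}"] by (simp add: axis_def)
    moreover have "a = (\<Sum>l\<in>{j. a $ j \<noteq> 0}. a $ l *s axis l 1)"
    proof -
      have "a = (\<Sum>l\<in>UNIV. a $ l *s axis l 1)" by (simp add: basis_expansion)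
      also have "\<dots> = (\<Sum>l\<in>{j. a $ j \<noteq> 0}. a $ l *s axis l 1)"
        by (intro sum.mono_neutral_right) auto
      finally show ?thesis .
    qed
    ultimately show ?case
      by (intro exI[of _ "{j. a $ j \<noteq> 0}"] exI[of _ "\<lambda>l. axis l 1"] exI[of _ "\<lambda>l. a $ l"]) auto
  next
    case (insert s C)
    obtain L :: "'d set" and u c where L: "card L + card C = card {j. a $ j \<noteq> 0}"
      and u: "\<And>l j. l \<in> L \<Longrightarrow> u l $ j \<in> entry_ring v C" and sum: "a = (\<Sum>l\<in>L. c l *s u l)"
      using insert by auto
    obtain j where j: "a $ j \<noteq> 0" "v j s \<noteq> 0" using insert.prems(2) by blast
    have "\<exists>l\<in>L. u l $ j \<noteq> 0"
    proof (rule ccontr)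
      assume "\<not> ?thesis"
      then have "a $ j = 0" by (subst sum) simp
      then show False using j(1) by simp
    qed
    then obtain p where p: "p \<in> L" "u p $ j \<noteq> 0" by blast
    define d where "d l = pairing (u l) (vector_config v s)" for l
    have d_eq: "d l = (\<Sum>j\<in>UNIV. u l $ j * v j s)" for l
      by (simp add: d_def pairing_def vector_config_def)
    have dp: "d p \<noteq> 0"
    proof
      assume "d p = 0"
      then have "u p $ j = 0"
        using insert.hyps insert.prems(1) u[OF p(1)] j(2) d_eq[of p]
        by (intro generic_column_independent[OF gen, of C s "\<lambda>j. u p $ j"]) auto
      then show False using p(2) by simp
    qed
    have u': "u l $ j \<in> entry_ring v (insert s C)" if "l \<in> L" for l j
      using u[OF that] entry_ring_mono[of C "insert s C" v] by blast
    have d: "d l \<in> entry_ring v (insert s C)" if "l \<in> L" for l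
      unfolding d_eq by (intro entry_ring_sum entry_ring_mult u' that entry_ring_entry) simp
    have "0 = pairing a (vector_config v s)" using insert.prems(3) by simp
    also have "\<dots> = (\<Sum>l\<in>L. c l * d l)" by (subst sum) (simp add: pairing_sum_left d_def)
    also have "\<dots> = c p * d p + (\<Sum>l\<in>L - {p}. c l * d l)" using p(1) by (intro sum.remove) auto
    \<comment> \<open>The vanishing of \<open>a\<close> on the new vector expresses the coefficient
      of the pivot \<open>p\<close> by the others.\<close>
    finally have cp: "c p = - ((\<Sum>l\<in>L - {p}. c l * d l) / d p)"
      using dp by (simp add: field_simps eq_neg_iff_add_eq_0)
    \<comment> \<open>Elimination by cross-multiplication: only the coefficients are divided by
      \<open>d p\<close>, so the new family keeps its entries in the ring.\<close>
    have "a = (\<Sum>l\<in>L - {p}. (c l / d p) *s (d p *s u l - d l *s u p))"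
    proof (rule vec_eq_iff[THEN iffD2, rule_format])
      fix i
      have "a $ i = (\<Sum>l\<in>L. c l * u l $ i)" by (subst sum) simp
      also have "\<dots> = c p * u p $ i + (\<Sum>l\<in>L - {p}. c l * u l $ i)"
        using p(1) by (intro sum.remove) auto
      also have "\<dots> = (\<Sum>l\<in>L - {p}. c l * u l $ i - c l * d l / d p * u p $ i)"
        by (simp add: cp sum_subtractf sum_divide_distrib sum_distrib_right)
      also have "\<dots> = (\<Sum>l\<in>L - {p}. (c l / d p) *s (d p *s u l - d l *s u p)) $ i"
        using dp by (simp add: algebra_simps)
      finally show "a $ i = (\<Sum>l\<in>L - {p}. (c l / d p) *s (d p *s u l - d l *s u p)) $ i" .
    qed
    moreover have "card (L - {p}) + card (insert s C) = card {j. a $ j \<noteq> 0}"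
      using L card_Suc_Diff1[OF _ p(1)] insert.hyps by simp
    moreover have "(d p *s u l - d l *s u p) $ j \<in> entry_ring v (insert s C)" if "l \<in> L - {p}" for l j
      using that p(1) by (simp add: entry_ring_diff entry_ring_mult d u')
    ultimately show ?case
      by (intro exI[of _ "L - {p}"] exI[of _ "\<lambda>l. d p *s u l - d l *s u p"] exI[of _ "\<lambda>l. c l / d p"]) auto
  qed
  then obtain L :: "'d set" and u c where L: "card L + card C = card {j. a $ j \<noteq> 0}"
    and sum: "a = (\<Sum>l\<in>L. c l *s u l)" by blast
  have "L \<noteq> {}" using a sum by auto
  then have "card L > 0" by (simp add: card_gt_0_iff)
  then show ?thesis using L by linarith
qed

section \<open>The power ideal is monomial\<close>

lemma keys_lin_power:
  assumes "m \<in> Poly_Mapping.keys (lin a ^ n)"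
  shows "Poly_Mapping.keys m \<subseteq> {j. a $ j \<noteq> 0} \<and> (\<Sum>j\<in>UNIV. Poly_Mapping.lookup m j) = n"
  using assms
proof (induction n arbitrary: m)
  case 0
  then show ?case by simp
next
  case (Suc n)
  have "Poly_Mapping.keys (lin a) \<subseteq> (\<lambda>j. Poly_Mapping.single j 1) ` {j. a $ j \<noteq> 0}"
    using Poly_Mapping.keys_sum[of "\<lambda>j. Poly_Mapping.single (Poly_Mapping.single j 1) (a $ j)" UNIV]
    unfolding lin_def by (auto simp del: One_nat_def split: if_splits)
  moreover obtain k m' where m: "m = k + m'" "k \<in> Poly_Mapping.keys (lin a)"
      "m' \<in> Poly_Mapping.keys (lin a ^ n)"
    using Suc.prems Poly_Mapping.keys_mult[of "lin a" "lin a ^ n"] by auto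
  ultimately obtain j where j: "a $ j \<noteq> 0" "k = Poly_Mapping.single j 1" by blast
  have "Poly_Mapping.keys m \<subseteq> insert j (Poly_Mapping.keys m')"
    using Poly_Mapping.keys_add[of k m'] unfolding m(1) j(2) by auto
  moreover have "(\<Sum>i\<in>UNIV. Poly_Mapping.lookup m i) = 1 + (\<Sum>i\<in>UNIV. Poly_Mapping.lookup m' i)"
    by (simp add: m(1) j(2) lookup_add sum.distrib lookup_single when_def)
  ultimately show ?case using Suc.IH[OF m(3)] j(1) by auto
qed

lemma in_ideal_generated_if_monomials:
  assumes "\<And>m. m \<in> Poly_Mapping.keys p \<Longrightarrow> Poly_Mapping.single m 1 \<in> ideal_generated G"
  shows "(p :: ('i, 'a::comm_ring_1) mpolynomial) \<in> ideal_generated G"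
proof -
  have "p = (\<Sum>m\<in>Poly_Mapping.keys p. Poly_Mapping.single 0 (Poly_Mapping.lookup p m) * Poly_Mapping.single m 1)"
    by (subst (1) poly_mapping_sum_single[of p]) (simp add: mult_single)
  also have "\<dots> \<in> ideal_generated G"
    by (intro ideal_generated_sum ideal_generated_mult assms)
  finally show ?thesis .
qed

theorem theorem4p1:
  fixes S :: "'s set"
    and A :: "'d::finite \<Rightarrow> 's set"
    and v :: "'d \<Rightarrow> 's \<Rightarrow> 'k::real_field"
    and l :: "'s set \<Rightarrow> ('d, 'k) mpolynomial"
  assumes "finite S"
    and "set_system S A"
    and "matroid_rank (transversal_matroid A) = CARD('d)"
    and "generic_scalars S A v"
    and "\<And>H. H \<in> config_hyperplanes S (vector_config v)
           \<Longrightarrow> defining_form S (vector_config v) H (l H)"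
  shows "monomial_ideal (power_ideal S (vector_config v) l)"
proof -
  let ?V = "vector_config v"
  let ?deg = "\<lambda>m :: 'd \<Rightarrow>\<^sub>0 nat. \<Sum>j\<in>UNIV. Poly_Mapping.lookup m j"
  let ?mon = "\<lambda>m :: 'd \<Rightarrow>\<^sub>0 nat. Poly_Mapping.single m (1::'k)"
  define N where "N J = {s \<in> S. \<exists>j\<in>J. v j s \<noteq> 0}" for J
  define M where "M = {m. \<exists>J. J \<noteq> {} \<and> Poly_Mapping.keys m \<subseteq> J \<and> card (N J) + 1 \<le> ?deg m + card J}"
  have pairing_V: "pairing a (?V s) = (\<Sum>j\<in>UNIV. a $ j * v j s)" for a s
    by (simp add: pairing_def vector_config_def)
  have "l H ^ card (S - H) \<in> ideal_generated (?mon ` M)" if H: "H \<in> config_hyperplanes S ?V" for H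
  proof -
    obtain a where a: "l H = lin a" "a \<noteq> 0" "H = {s \<in> S. pairing a (?V s) = 0}"
      using assms(5)[OF H] by (rule config_hyperplane_form)
    let ?J = "{j. a $ j \<noteq> 0}"
    have "?J \<noteq> {}" using a(2) by (auto simp: vec_eq_iff)
    have "S - H \<subseteq> N ?J"
    proof
      fix s assume "s \<in> S - H"
      then have "s \<in> S" "(\<Sum>j\<in>UNIV. a $ j * v j s) \<noteq> 0" by (auto simp: a(3) pairing_V)
      then obtain j where "a $ j * v j s \<noteq> 0" by (meson sum.neutral)
      with \<open>s \<in> S\<close> show "s \<in> N ?J" by (auto simp: N_def)
    qed
    then have "N ?J = (S - H) \<union> (N ?J \<inter> H)" unfolding N_def by blast
    then have "card (N ?J) \<le> card (S - H) + card (N ?J \<inter> H)" by (metis card_Un_le)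
    \<comment> \<open>Genericity enters here: each of these labels has a nonzero entry on the
      support of \<open>a\<close>, yet its vector is annihilated by \<open>a\<close>.\<close>
    moreover have "card (N ?J \<inter> H) < card ?J"
      using assms(1) by (intro card_annihilated_generic_vectors[OF assms(4) a(2)]) (auto simp: N_def a(3))
    ultimately have "card (N ?J) + 1 \<le> card (S - H) + card ?J" by linarith
    then have M: "m \<in> M" if "m \<in> Poly_Mapping.keys (lin a ^ card (S - H))" for m
      using keys_lin_power[OF that] \<open>?J \<noteq> {}\<close> unfolding M_def by (intro CollectI exI[of _ ?J]) simp
    show ?thesis
      unfolding a(1)
      by (rule in_ideal_generated_if_monomials) (intro ideal_generated_base imageI M)
  qed
  then have "power_ideal S ?V l \<subseteq> ideal_generated (?mon ` M)"
    unfolding power_ideal_def by (intro ideal_generated_minimal) blast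
  moreover have "?mon m \<in> power_ideal S ?V l" if "m \<in> M" for m
  proof -
    obtain J where J: "J \<noteq> {}" "Poly_Mapping.keys m \<subseteq> J" "card (N J) + 1 \<le> ?deg m + card J"
      using \<open>m \<in> M\<close> unfolding M_def by blast
    \<comment> \<open>The coordinate forms of \<open>J\<close> vanish outside \<open>N J\<close>, so
      they lie in this space and its dimension is at least \<open>card J\<close>; conversely, its
      forms can be nonzero only at labels in \<open>N J\<close>.\<close>
    let ?U = "annihilator ?V (S - N J)"
    let ?B = "(\<lambda>j. axis j 1) ` J :: ('k ^ 'd) set"
    have B: "?B \<subseteq> ?U"
      by (auto simp: annihilator_def N_def vector_config_def)
    have "vec.independent ?B"
      by (rule vec.independent_mono[OF independent_cart_basis]) (auto simp: cart_basis_def)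
    then have "card ?B \<le> vec.dim ?U" using B by (intro vec.independent_card_le_dim)
    moreover have "card ?B = card J" by (intro card_image inj_onI) (simp add: axis_eq_axis)
    ultimately have dim: "card J \<le> vec.dim ?U" by simp
    moreover have "card J \<ge> 1" using J(1) by (simp add: Suc_le_eq card_gt_0_iff)
    moreover obtain us :: "('k ^ 'd) list" where us: "set us \<subseteq> ?B" "length us = ?deg m"
        "prod_list (map lin us) = ?mon m"
      using prod_list_lin_axis[OF J(2)] by blast
    moreover have "{s \<in> S. \<exists>a\<in>?U. pairing a (?V s) \<noteq> 0} \<subseteq> N J"
      by (auto simp: annihilator_def)
    then have "card {s \<in> S. \<exists>a\<in>?U. pairing a (?V s) \<noteq> 0} \<le> card (N J)"
      using assms(1) by (intro card_mono) (auto simp: N_def)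
    ultimately have "prod_list (map lin us) \<in> power_ideal S ?V l"
      using B J(3) by (intro annihilator_products_in_power_ideal[where F = "S - N J"] assms(1,5)) auto
    then show ?thesis using us(3) by simp
  qed
  then have "ideal_generated (?mon ` M) \<subseteq> power_ideal S ?V l"
    unfolding power_ideal_def by (intro ideal_generated_minimal) blast
  ultimately show ?thesis unfolding monomial_ideal_def by blast
qed

end
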